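(* Let $j\ge 2$ be an integer. Then there is a constant $\gamma_j$ such that, as $n\to\infty$ through the integers, $$ l_j(n)-\ln_j(n)=\gamma_j+\frac{1}{2n\ln n\,\ln_2 n\cdots\ln_{j-1}n}+O\!\left(\frac{1}{n^{2}\ln n\,\ln_2 n\cdots \ln_{j-1}n}\right). $$
   Context: $\ln_1=\ln$ is the natural logarithm and, for $i\ge 2$, $\ln_i=\ln\circ\ln_{i-1}$ is the $i$-fold iterated natural logarithm (equivalently $\ln_i(x)=\int_{{}^{i-1}e}^{x}\frac{dt}{t\ln_1 t\cdots\ln_{i-1}t}$). Here the hyperpowers of $e$ are ${}^0e=1$, ${}^1e=e$, ${}^{i}e=e^{\,{}^{i-1}e}$; the domain of $\ln_i$ is $({}^{i-2}e,\infty)$ for $i\ge2$. For $j\ge 1$ define $$ l_j(n)=\sum_{k=a}^{n}\frac{1}{k\ln k\,\ln_2 k\cdots\ln_{j-1}k},$$ where $a=a(j)$ is given by $a(1)=1$, $a(2)=2$, and $a(j)=\lceil {}^{j-2}e\rceil$ for $j\ge 3$ (the smallest positive integer at which all factors of the summand are defined and positive). *)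

theory Defs
  imports Complex_Main "HOL-Library.Landau_Symbols"
begin

(* The index 0 gives the identity; the iterated logarithms proper are those with i >= 1. *)
definition iter_ln :: "nat \<Rightarrow> real \<Rightarrow> real" where
  "iter_ln i = (ln ^^ i)"

primrec hyperpow_e :: "nat \<Rightarrow> real" where
  "hyperpow_e 0 = 1"
| "hyperpow_e (Suc i) = exp (hyperpow_e i)"

definition log_prod :: "nat \<Rightarrow> real \<Rightarrow> real" where
  "log_prod j x = (\<Prod>i=1..j-1. iter_ln i x)"

definition start_index :: "nat \<Rightarrow> nat" where
  "start_index j =
     (if j = 1 then 1 else if j = 2 then 2 else nat \<lceil>hyperpow_e (j - 2)\<rceil>)"

definition log_sum :: "nat \<Rightarrow> nat \<Rightarrow> real" where
  "log_sum j n = (\<Sum>k=start_index j..n. 1 / (real k * log_prod j (real k)))"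

end

theory Submission imports Defs
begin

text \<open>
  Put f(x) = 1/(x ln x \<dots> ln_{j-1} x), so that ln_j' = f and -f' = f s with
  s the sum of the functions 1/(x ln x \<dots> ln_{i-1} x) over i = 1, \<dots>, j.  Both f and s are
  positive and decreasing for large x, so f' is increasing and the error of the trapezoidal rule
  on [n, n+1] is at most (f'(n+1) - f'(n))/2.  These bounds telescope: l_j(n) - ln_j(n) - f(n)/2
  converges, with remainder at most -f'(n)/2, and -f'(n) \<le> j f(n)/n.
\<close>

section \<open>Trapezoidal rule and summation of its errors\<close>

text \<open>Since the slope \<open>- q\<close> of \<open>f\<close> increases from
  \<open>- q a\<close> to \<open>- q b\<close>, the graph of \<open>f\<close> lies between the two
  lines through \<open>(a, f a)\<close> with these slopes. This traps both \<open>f b\<close>, hence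
  the trapezoid, and the integral \<open>F b - F a\<close>.\<close>

lemma trapezoid_error_bound:
  fixes F f q :: "real \<Rightarrow> real"
  assumes ab: "a \<le> b"
    and F: "\<And>x. a \<le> x \<Longrightarrow> x \<le> b \<Longrightarrow> (F has_real_derivative f x) (at x)"
    and f: "\<And>x. a \<le> x \<Longrightarrow> x \<le> b \<Longrightarrow> (f has_real_derivative - q x) (at x)"
    and q: "\<And>x y. a \<le> x \<Longrightarrow> x \<le> y \<Longrightarrow> y \<le> b \<Longrightarrow> q y \<le> q x"
  shows "\<bar>(b - a) * (f a + f b) / 2 - (F b - F a)\<bar> \<le> (b - a)\<^sup>2 * (q a - q b) / 2"
proof -
  have lower: "f a - q a * (x - a) \<le> f x" if x: "a \<le> x" "x \<le> b" for x
  proof -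
    have "f a + q a * (a - a) \<le> f x + q a * (x - a)"
    proof (rule DERIV_nonneg_imp_nondecreasing[OF x(1)])
      fix t assume t: "a \<le> t" "t \<le> x"
      have "((\<lambda>x. f x + q a * (x - a)) has_real_derivative - q t + q a) (at t)"
        using t x by (auto intro!: derivative_eq_intros f)
      then show "\<exists>y. ((\<lambda>x. f x + q a * (x - a)) has_real_derivative y) (at t) \<and> 0 \<le> y"
        using q[of a t] t x by fastforce
    qed
    then show ?thesis by simp
  qed
  have upper: "f x \<le> f a - q b * (x - a)" if x: "a \<le> x" "x \<le> b" for x
  proof -
    have "f a + q b * (a - a) \<ge> f x + q b * (x - a)"
    proof (rule DERIV_nonpos_imp_nonincreasing[OF x(1)])
      fix t assume t: "a \<le> t" "t \<le> x"
      have "((\<lambda>x. f x + q b * (x - a)) has_real_derivative - q t + q b) (at t)"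
        using t x by (auto intro!: derivative_eq_intros f)
      then show "\<exists>y. ((\<lambda>x. f x + q b * (x - a)) has_real_derivative y) (at t) \<and> y \<le> 0"
        using q[of t b] t x by fastforce
    qed
    then show ?thesis by simp
  qed
  have int_lower: "f a * (b - a) - q a * (b - a)\<^sup>2 / 2 \<le> F b - F a"
  proof -
    \<comment> \<open>Subtracting the antiderivative of the lower line from \<open>F\<close> leaves
      a function with nonnegative derivative, so the line is integrated by monotonicity
      alone.\<close>
    let ?h = "\<lambda>x. F x - f a * (x - a) + q a * (x - a)\<^sup>2 / 2"
    have "?h a \<le> ?h b"
    proof (rule DERIV_nonneg_imp_nondecreasing[OF ab])
      fix t assume t: "a \<le> t" "t \<le> b"
      have "(?h has_real_derivative f t - f a + q a * (t - a)) (at t)"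
        using t by (auto intro!: derivative_eq_intros F)
      then show "\<exists>y. (?h has_real_derivative y) (at t) \<and> 0 \<le> y"
        using lower[OF t] by fastforce
    qed
    then show ?thesis by simp
  qed
  have int_upper: "F b - F a \<le> f a * (b - a) - q b * (b - a)\<^sup>2 / 2"
  proof -
    let ?h = "\<lambda>x. F x - f a * (x - a) + q b * (x - a)\<^sup>2 / 2"
    have "?h a \<ge> ?h b"
    proof (rule DERIV_nonpos_imp_nonincreasing[OF ab])
      fix t assume t: "a \<le> t" "t \<le> b"
      have "(?h has_real_derivative f t - f a + q b * (t - a)) (at t)"
        using t by (auto intro!: derivative_eq_intros F)
      then show "\<exists>y. (?h has_real_derivative y) (at t) \<and> y \<le> 0"
        using upper[OF t] by fastforce
    qed
    then show ?thesis by simp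
  qed
  have "(b - a) * (f a - q a * (b - a)) \<le> (b - a) * f b"
    using lower[of b] ab by (intro mult_left_mono) auto
  then have end_lower: "f a * (b - a) - q a * (b - a)\<^sup>2 \<le> f b * (b - a)"
    by (simp add: algebra_simps power2_eq_square)
  have "(b - a) * f b \<le> (b - a) * (f a - q b * (b - a))"
    using upper[of b] ab by (intro mult_left_mono) auto
  then have end_upper: "f b * (b - a) \<le> f a * (b - a) - q b * (b - a)\<^sup>2"
    by (simp add: algebra_simps power2_eq_square)
  \<comment> \<open>With \<open>A\<close> the rectangle of height \<open>f a\<close> and
    \<open>C\<close>, \<open>D\<close> equal to \<open>q a\<close>, \<open>q b\<close> times the
    squared length, the trapezoid and the integral both lie in the interval from
    \<open>A - C / 2\<close> to \<open>A - D / 2\<close>.\<close>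
  have "\<bar>(A + B) / 2 - I\<bar> \<le> (C - D) / 2"
    if "A - C \<le> B" "B \<le> A - D" "A - C / 2 \<le> I" "I \<le> A - D / 2" for A B C D I :: real
    using that by argo
  from this[OF end_lower end_upper int_lower int_upper] show ?thesis
    by (simp only: distrib_left left_diff_distrib right_diff_distrib mult.commute)
qed

text \<open>The corrected difference \<open>g\<close> changes in each step by at most half the drop
  of \<open>q\<close>. Hence \<open>g - q / 2\<close> increases and \<open>g + q / 2\<close>
  decreases, and as \<open>q\<close> tends to 0 they enclose a common limit, the constant
  \<gamma>.\<close>

lemma sum_minus_antiderivative_expansion:
  fixes F f q :: "real \<Rightarrow> real" and S :: "nat \<Rightarrow> real"
  assumes S: "\<And>n. N \<le> n \<Longrightarrow> S (Suc n) = S n + f (real (Suc n))"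
    and F: "\<And>x. real N \<le> x \<Longrightarrow> (F has_real_derivative f x) (at x)"
    and f: "\<And>x. real N \<le> x \<Longrightarrow> (f has_real_derivative - q x) (at x)"
    and q: "\<And>x y. real N \<le> x \<Longrightarrow> x \<le> y \<Longrightarrow> q y \<le> q x"
    and q_nonneg: "\<And>x. real N \<le> x \<Longrightarrow> 0 \<le> q x"
    and q_lim: "(\<lambda>n. q (real n)) \<longlonglongrightarrow> 0"
  shows "\<exists>\<gamma>. \<forall>n\<ge>N. \<bar>S n - F (real n) - (\<gamma> + f (real n) / 2)\<bar> \<le> q (real n) / 2"
proof -
  define g where "g n = S n - F (real n) - f (real n) / 2" for n
  have step: "\<bar>g (Suc n) - g n\<bar> \<le> (q (real n) - q (real (Suc n))) / 2" if n: "N \<le> n" for n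
  proof -
    have "\<bar>(real (Suc n) - real n) * (f (real n) + f (real (Suc n))) / 2
        - (F (real (Suc n)) - F (real n))\<bar>
        \<le> (real (Suc n) - real n)\<^sup>2 * (q (real n) - q (real (Suc n))) / 2"
      using n by (intro trapezoid_error_bound F f q) auto
    moreover have "g (Suc n) - g n
        = (f (real n) + f (real (Suc n))) / 2 - (F (real (Suc n)) - F (real n))"
      unfolding g_def S[OF n] by (simp add: field_simps)
    ultimately show ?thesis by simp
  qed
  \<comment> \<open>The shift by \<open>N\<close> makes the monotonicity hold at every index, as
    nested sequences require.\<close>
  define u where "u n = g (n + N) - q (real (n + N)) / 2" for n
  define v where "v n = g (n + N) + q (real (n + N)) / 2" for n
  have "u n \<le> u (Suc n)" "v (Suc n) \<le> v n" for n
    using step[of "n + N", OF le_add2] unfolding u_def v_def add_Suc by argo+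
  moreover have "u n \<le> v n" for n
    using q_nonneg[of "real (n + N)"] by (simp add: u_def v_def)
  moreover have "(\<lambda>n. u n - v n) \<longlonglongrightarrow> 0"
    using tendsto_minus[OF LIMSEQ_ignore_initial_segment[OF q_lim, of N]]
    by (simp add: u_def v_def)
  ultimately obtain \<gamma> where \<gamma>: "\<And>n. u n \<le> \<gamma>" "\<And>n. \<gamma> \<le> v n"
    using nested_sequence_unique[of u v] by blast
  have "\<bar>S n - F (real n) - (\<gamma> + f (real n) / 2)\<bar> \<le> q (real n) / 2" if "N \<le> n" for n
  proof -
    have "g n - q (real n) / 2 \<le> \<gamma>" "\<gamma> \<le> g n + q (real n) / 2"
      using \<gamma>[of "n - N"] that by (simp_all add: u_def v_def)
    then show ?thesis unfolding g_def by argo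
  qed
  then show ?thesis by blast
qed

section \<open>Iterated logarithms beyond the hyperpowers of e\<close>

lemma iter_ln_Suc: "iter_ln (Suc i) x = ln (iter_ln i x)"
  by (simp add: iter_ln_def)

lemma hyperpow_e_ge_1: "1 \<le> hyperpow_e i"
  by (induction i) (auto intro: order_trans[OF _ exp_ge_add_one_self])

text \<open>Each logarithm removes one exponential from the tower. The height \<open>k\<close> is
  left free because the induction uses it at \<open>Suc k\<close>.\<close>

lemma iter_ln_ge_hyperpow_e:
  assumes "hyperpow_e (i + k) \<le> x"
  shows "hyperpow_e k \<le> iter_ln i x"
  using assms
proof (induction i arbitrary: k)
  case 0
  then show ?case by (simp add: iter_ln_def)
next
  case (Suc i)
  then have "exp (hyperpow_e k) \<le> iter_ln i x"
    using Suc.IH[of "Suc k"] by simp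
  then show ?case
    by (metis exp_gt_zero iter_ln_Suc less_le_trans ln_ge_iff)
qed

text \<open>The single threshold \<open>hyperpow_e j\<close> serves all indices up to
  \<open>j\<close>; the bound 1, rather than mere positivity, later gives
  \<open>log_density i x \<le> 1 / x\<close>.\<close>

lemma iter_ln_ge_1:
  assumes "i \<le> j" "hyperpow_e j \<le> x"
  shows "1 \<le> iter_ln i x"
  using iter_ln_ge_hyperpow_e[of i "j - i" x] hyperpow_e_ge_1[of "j - i"] assms by simp

lemma log_prod_Suc: "1 \<le> i \<Longrightarrow> log_prod (Suc i) x = log_prod i x * iter_ln i x"
  by (cases i) (simp_all add: log_prod_def)

lemma log_prod_ge_1:
  assumes "i \<le> j" "hyperpow_e j \<le> x"
  shows "1 \<le> log_prod i x"
  unfolding log_prod_def using assms by (intro prod_ge_1 iter_ln_ge_1[of _ j]) auto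

section \<open>The summand as a function of a real variable, and its derivative\<close>

text \<open>This is the derivative of \<open>iter_ln i\<close> and, for \<open>i = j\<close>, the
  function f of the overview. The index varies because the derivative of f involves all lower
  indices.\<close>

definition log_density :: "nat \<Rightarrow> real \<Rightarrow> real" where
  "log_density i x = 1 / (x * log_prod i x)"

lemma log_density_Suc: "1 \<le> i \<Longrightarrow> log_density (Suc i) x = log_density i x / iter_ln i x"
  by (simp add: log_density_def log_prod_Suc)

lemma log_density_pos:
  assumes "i \<le> j" "hyperpow_e j \<le> x"
  shows "0 < log_density i x"
  using log_prod_ge_1[OF assms] hyperpow_e_ge_1[of j] assms by (simp add: log_density_def)

lemma log_density_le:
  assumes "i \<le> j" "hyperpow_e j \<le> x"
  shows "log_density i x \<le> 1 / x"
  using log_prod_ge_1[OF assms] hyperpow_e_ge_1[of j] assms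
  by (simp add: log_density_def field_simps)

lemma iter_ln_has_real_derivative:
  assumes "1 \<le> i" "i \<le> j" "hyperpow_e j \<le> x"
  shows "(iter_ln i has_real_derivative log_density i x) (at x)"
  using assms(1,2)
proof (induction i rule: nat_induct_at_least)
  case base
  have "iter_ln 1 = ln" by (simp add: iter_ln_def fun_eq_iff)
  then show ?case
    using hyperpow_e_ge_1[of j] assms(3)
    by (auto simp: log_density_def log_prod_def intro!: derivative_eq_intros)
next
  case (Suc i)
  have "1 \<le> iter_ln i x" using iter_ln_ge_1[of i j x] assms Suc by simp
  then have "((\<lambda>x. ln (iter_ln i x)) has_real_derivative log_density (Suc i) x) (at x)"
    using Suc by (auto simp: log_density_Suc intro!: derivative_eq_intros)
  moreover have "(\<lambda>x. ln (iter_ln i x)) = iter_ln (Suc i)"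
    by (simp add: iter_ln_Suc fun_eq_iff)
  ultimately show ?case by simp
qed

text \<open>The sum is minus the logarithmic derivative: passing from \<open>i\<close> to
  \<open>Suc i\<close> divides by \<open>iter_ln i\<close>, whose own logarithmic derivative
  \<open>log_density i x / iter_ln i x\<close> is exactly the new term
  \<open>log_density (Suc i) x\<close>.\<close>

lemma log_density_has_real_derivative:
  assumes "1 \<le> i" "i \<le> j" "hyperpow_e j \<le> x"
  shows "(log_density i has_real_derivative
    - (log_density i x * (\<Sum>k=1..i. log_density k x))) (at x)"
  using assms(1,2)
proof (induction i rule: nat_induct_at_least)
  case base
  have "log_density 1 = (\<lambda>x. 1 / x)" by (simp add: log_density_def log_prod_def fun_eq_iff)
  then show ?case
    using hyperpow_e_ge_1[of j] assms(3) by (auto intro!: derivative_eq_intros)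
next
  case (Suc i)
  have L: "1 \<le> iter_ln i x" using iter_ln_ge_1[of i j x] assms Suc by simp
  have "((\<lambda>x. log_density i x / iter_ln i x) has_real_derivative
      (- (log_density i x * (\<Sum>k=1..i. log_density k x)) * iter_ln i x
        - log_density i x * log_density i x) / (iter_ln i x * iter_ln i x)) (at x)"
    using Suc L assms by (intro DERIV_divide iter_ln_has_real_derivative[of _ j]) auto
  also have "(- (log_density i x * (\<Sum>k=1..i. log_density k x)) * iter_ln i x
        - log_density i x * log_density i x) / (iter_ln i x * iter_ln i x)
      = - (log_density (Suc i) x * (\<Sum>k=1..Suc i. log_density k x))"
    using Suc L by (simp add: log_density_Suc field_simps)
  also have "(\<lambda>x. log_density i x / iter_ln i x) = log_density (Suc i)"
    using Suc by (simp add: log_density_Suc fun_eq_iff)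
  finally show ?case .
qed

lemma log_density_antimono:
  assumes "1 \<le> i" "i \<le> j" "hyperpow_e j \<le> x" "x \<le> y"
  shows "log_density i y \<le> log_density i x"
proof (rule DERIV_nonpos_imp_nonincreasing[OF assms(4)])
  fix t assume t: "x \<le> t" "t \<le> y"
  have "0 \<le> log_density i t * (\<Sum>k=1..i. log_density k t)"
    using t assms by (intro mult_nonneg_nonneg sum_nonneg less_imp_le[OF log_density_pos[of _ j]]) auto
  then show "\<exists>z. (log_density i has_real_derivative z) (at t) \<and> z \<le> 0"
    using log_density_has_real_derivative[of i j t] t assms by fastforce
qed

lemma sum_log_density_le:
  assumes "hyperpow_e j \<le> x"
  shows "(\<Sum>k=1..j. log_density k x) \<le> real j / x"
  using sum_mono[of "{1..j}" "\<lambda>k. log_density k x" "\<lambda>_. 1 / x"] log_density_le[of _ j x] assms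
  by simp

section \<open>The asymptotic expansion\<close>

theorem theorem1:
  fixes j :: nat
  assumes "j \<ge> 2"
  shows "\<exists>\<gamma>::real.
    (\<lambda>n::nat. log_sum j n - iter_ln j (real n)
        - (\<gamma> + 1 / (2 * real n * log_prod j (real n))))
    \<in> O(\<lambda>n. 1 / ((real n)\<^sup>2 * log_prod j (real n)))"
proof -
  define q where "q x = log_density j x * (\<Sum>k=1..j. log_density k x)" for x
  \<comment> \<open>Beyond \<open>start_index j\<close> each increment of \<open>n\<close> adds
    exactly one summand; beyond \<open>hyperpow_e j\<close> the analytic lemmas apply.\<close>
  define N where "N = max (start_index j) (nat \<lceil>hyperpow_e j\<rceil>)"
  have N: "hyperpow_e j \<le> x" if "real N \<le> x" for x
    using that unfolding N_def by linarith
  have q_nonneg: "0 \<le> q x" if "real N \<le> x" for x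
    unfolding q_def using N[OF that]
    by (intro mult_nonneg_nonneg sum_nonneg less_imp_le[OF log_density_pos[of _ j]]) auto
  have q_le: "q x \<le> log_density j x * (real j / x)" if "real N \<le> x" for x
    unfolding q_def using N[OF that] log_density_pos[of j j x]
    by (intro mult_left_mono sum_log_density_le) auto
  \<comment> \<open>The cruder bound of order \<open>1 / x\<^sup>2\<close> suffices for the limit of
    \<open>q\<close>; the sharper \<open>q_le\<close> keeps the factor
    \<open>log_density j x\<close> needed in the error term.\<close>
  have q_le': "q x \<le> 1 / x * (real j / x)" if "real N \<le> x" for x
    using q_le[OF that] log_density_le[of j j x] N[OF that] hyperpow_e_ge_1[of j]
    by (meson divide_nonneg_nonneg dual_order.trans le_refl mult_right_mono of_nat_0_le_iff zero_le_one)
  have "\<exists>\<gamma>. \<forall>n\<ge>N. \<bar>log_sum j n - iter_ln j (real n) - (\<gamma> + log_density j (real n) / 2)\<bar>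
      \<le> q (real n) / 2"
  proof (rule sum_minus_antiderivative_expansion)
    show "log_sum j (Suc n) = log_sum j n + log_density j (real (Suc n))" if "N \<le> n" for n
      using that by (simp add: log_sum_def log_density_def N_def)
    show "(iter_ln j has_real_derivative log_density j x) (at x)" if "real N \<le> x" for x
      using iter_ln_has_real_derivative[of j j] N[OF that] assms by simp
    show "(log_density j has_real_derivative - q x) (at x)" if "real N \<le> x" for x
      using log_density_has_real_derivative[of j j] N[OF that] assms by (simp add: q_def)
    show "q y \<le> q x" if "real N \<le> x" "x \<le> y" for x y
      \<comment> \<open>Both factors of \<open>q\<close> are positive and decreasing.\<close>
      unfolding q_def using N[of x] N[of y] that assms
      by (intro mult_mono sum_mono sum_nonneg log_density_antimono[of _ j]
          less_imp_le[OF log_density_pos[of _ j]]) auto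
    show "0 \<le> q x" if "real N \<le> x" for x
      by (rule q_nonneg[OF that])
    show "(\<lambda>n. q (real n)) \<longlonglongrightarrow> 0"
    proof (rule tendsto_sandwich[of "\<lambda>_. 0" _ _ "\<lambda>n. 1 / real n * (real j / real n)"])
      show "\<forall>\<^sub>F n in sequentially. 0 \<le> q (real n)"
        using eventually_ge_at_top[of N] by eventually_elim (simp add: q_nonneg)
      show "\<forall>\<^sub>F n in sequentially. q (real n) \<le> 1 / real n * (real j / real n)"
        using eventually_ge_at_top[of N] by eventually_elim (rule q_le', simp)
      show "(\<lambda>n. 1 / real n * (real j / real n)) \<longlonglongrightarrow> 0"
        using tendsto_mult[OF lim_const_over_n[of 1] lim_const_over_n[of "real j"]] by simp
    qed simp
  qed
  then obtain \<gamma> where \<gamma>: "\<And>n. N \<le> n \<Longrightarrow>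
      \<bar>log_sum j n - iter_ln j (real n) - (\<gamma> + log_density j (real n) / 2)\<bar> \<le> q (real n) / 2"
    by blast
  have "(\<lambda>n::nat. log_sum j n - iter_ln j (real n)
        - (\<gamma> + 1 / (2 * real n * log_prod j (real n))))
    \<in> O(\<lambda>n. 1 / ((real n)\<^sup>2 * log_prod j (real n)))"
  \<comment> \<open>The factor \<open>j\<close> counts the terms in the logarithmic derivative, and
    the half comes from the trapezoidal error.\<close>
  proof (rule bigoI[of _ "real j / 2"])
    show "\<forall>\<^sub>F n in sequentially.
        norm (log_sum j n - iter_ln j (real n) - (\<gamma> + 1 / (2 * real n * log_prod j (real n))))
        \<le> real j / 2 * norm (1 / ((real n)\<^sup>2 * log_prod j (real n)))"
      using eventually_ge_at_top[of N]
    proof eventually_elim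
      case (elim n)
      have "\<bar>log_sum j n - iter_ln j (real n) - (\<gamma> + log_density j (real n) / 2)\<bar>
          \<le> log_density j (real n) * (real j / real n) / 2"
        using \<gamma>[OF elim] q_le[of "real n"] elim by simp
      moreover have "0 \<le> log_prod j (real n)"
        using log_prod_ge_1[of j j "real n"] N[of "real n"] elim by simp
      ultimately show ?case
        by (simp add: log_density_def power2_eq_square abs_mult mult_ac)
    qed
  qed
  then show ?thesis by blast
qed

end
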